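(* Let $W$ be an $n$-dimensional vector space over an arbitrary field $\mathbb F$, and let $t$ be an integer with $n\ge t\ge 0$. Suppose that $U_1,\ldots,U_m$ and $V_1,\ldots,V_m$ are subspaces of $W$ such that $\dim(U_i\cap V_i)\le t$ for $1\le i\le m$ and $\dim(U_i\cap V_j)>t$ for $1\le i<j\le m$. Then $m\le 2^{n-t}$. *)

theory Defs
  imports Complex_Main
begin

end

theory Submission
  imports Defs "Jordan_Normal_Form.Char_Poly"
begin

text \<open>
  Put \<open>r = n - t\<close>. Functionals annihilating \<open>U i\<close> or \<open>V i\<close> span the annihilator of
  \<open>U i \<inter> V i\<close>, so \<open>r\<close> independent ones can be chosen for each \<open>i\<close>, say \<open>b i\<close> of them killing
  \<open>U i\<close> and the rest killing \<open>V i\<close>. If \<open>i < j\<close> and \<open>b i = b j\<close>, the functionals of the first kind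
  for \<open>i\<close> and of the second kind for \<open>j\<close> all vanish on \<open>U i \<inter> V j\<close>, hence are dependent.
  Evaluating all functionals at \<open>r\<close> generic vectors with coordinates in the polynomial ring over
  the field (which is infinite even when the field is finite) gives rows in an \<open>r\<close>-dimensional
  space whose mixed determinants vanish for \<open>i < j\<close> but not for \<open>i = j\<close>. So the determinants with
  the second block of rows fixed are independent alternating forms in \<open>b\<close> vectors of an
  \<open>r\<close>-dimensional space, and each class \<open>b i = b\<close> has at most \<open>r choose b\<close> members;
  these bounds add up to \<open>2 ^ r\<close>.
\<close>

section \<open>Underdetermined homogeneous linear systems over an integral domain\<close>

lemma nontrivial_kernel:
  fixes A :: "'s \<Rightarrow> 'i \<Rightarrow> 'a::idom"
  assumes "finite I" "finite T" "card T < card I"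
  obtains c where "\<exists>i\<in>I. c i \<noteq> 0" "\<And>s. s \<in> T \<Longrightarrow> (\<Sum>i\<in>I. A s i * c i) = 0"
proof -
  define N M where "N = card I" and "M = card T"
  obtain h where h: "bij_betw h {0..<N} I" using ex_bij_betw_nat_finite assms(1) N_def by blast
  obtain g where g: "bij_betw g {0..<M} T" using ex_bij_betw_nat_finite assms(2) M_def by blast
  \<comment> \<open>Zero rows pad the system to a square one. Expansion along the zero row
    \<open>M\<close> makes the determinant 0, which over an integral domain yields a nonzero kernel
    vector.\<close>
  define B where "B = mat N N (\<lambda>(i,j). if i < M then A (g i) (h j) else 0)"
  have B: "B \<in> carrier_mat N N" by (simp add: B_def)
  have MN: "M < N" using assms(3) by (simp add: N_def M_def)
  have "det B = (\<Sum>j<N. B $$ (M,j) * cofactor B M j)"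
    by (rule laplace_expansion_row[OF B MN])
  also have "\<dots> = 0" using MN by (simp add: B_def)
  finally obtain v where v: "v \<in> carrier_vec N" "v \<noteq> 0\<^sub>v N" "B *\<^sub>v v = 0\<^sub>v N"
    using det_0_iff_vec_prod_zero[OF B] by blast
  obtain k where k: "k < N" "v $ k \<noteq> 0"
    using v(1,2) by (metis carrier_vecD eq_vecI index_zero_vec)
  define c where "c = (\<lambda>i. v $ (the_inv_into {0..<N} h i))"
  have inv: "the_inv_into {0..<N} h (h j) = j" if "j < N" for j
    using h that by (intro the_inv_into_f_f) (auto simp: bij_betw_def)
  show thesis
  proof
    show "\<exists>i\<in>I. c i \<noteq> 0"
      using k h inv[of k] by (intro bexI[of _ "h k"]) (auto simp: c_def bij_betw_def)
    fix s assume "s \<in> T"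
    then obtain i where i: "i < M" "s = g i" using g by (auto simp: bij_betw_def)
    have "0 = (B *\<^sub>v v) $ i" using v(3) i MN by simp
    also have "\<dots> = (\<Sum>j\<in>{0..<N}. A s (h j) * v $ j)"
      using i MN v(1) by (simp add: B_def scalar_prod_def)
    also have "\<dots> = (\<Sum>j\<in>{0..<N}. A s (h j) * c (h j))"
      by (intro sum.cong) (auto simp: c_def inv)
    also have "\<dots> = (\<Sum>i\<in>I. A s i * c i)"
      by (rule sum.reindex_bij_betw[OF h])
    finally show "(\<Sum>i\<in>I. A s i * c i) = 0" by simp
  qed
qed

section \<open>Alternating forms given by determinants, and a skew Bollobas bound for
  matrices\<close>

lemma det_row_expand_unit:
  fixes f :: "nat \<Rightarrow> nat \<Rightarrow> 'a::comm_ring_1"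
  assumes "i < r"
  shows "det (mat r r (\<lambda>(l,k). f l k)) =
    (\<Sum>q<r. f i q * det (mat r r (\<lambda>(l,k). (f(i := \<lambda>k. of_bool (k = q))) l k)))"
proof -
  let ?A = "mat r r (\<lambda>(l,k). f l k)"
  let ?B = "\<lambda>q. mat r r (\<lambda>(l,k). (f(i := \<lambda>k. of_bool (k = q))) l k)"
  \<comment> \<open>Cofactors along row \<open>i\<close> do not see that row, so the unit row
    \<open>q\<close> picks out the \<open>q\<close>-th cofactor of \<open>?A\<close>, and the claim
    becomes Laplace expansion.\<close>
  have cof: "cofactor (?B q) i j = cofactor ?A i j" if "j < r" for q j
  proof -
    have "mat_delete (?B q) i j = mat_delete ?A i j"
      using that assms by (intro eq_matI) (auto simp: mat_delete_def)
    then show ?thesis by (simp add: cofactor_def)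
  qed
  have B: "det (?B q) = cofactor ?A i q" if "q < r" for q
  proof -
    have "det (?B q) = (\<Sum>j<r. ?B q $$ (i,j) * cofactor (?B q) i j)"
      by (rule laplace_expansion_row) (use assms in auto)
    also have "\<dots> = (\<Sum>j<r. if j = q then cofactor ?A i j else 0)"
    proof (intro sum.cong refl)
      fix j assume "j \<in> {..<r}"
      then have "?B q $$ (i,j) = of_bool (j = q)" "cofactor (?B q) i j = cofactor ?A i j"
        using assms cof by auto
      then show "?B q $$ (i,j) * cofactor (?B q) i j = (if j = q then cofactor ?A i j else 0)"
        by (simp only: of_bool_def) simp
    qed
    finally show ?thesis using that by simp
  qed
  have "det ?A = (\<Sum>q<r. ?A $$ (i,q) * cofactor ?A i q)"
    by (rule laplace_expansion_row) (use assms in auto)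
  also have "\<dots> = (\<Sum>q<r. f i q * det (?B q))"
    by (intro sum.cong) (use assms in \<open>auto simp: B simp del: fun_upd_apply\<close>)
  finally show ?thesis .
qed

definition splice_rows :: "nat \<Rightarrow> (nat \<Rightarrow> 'a) \<Rightarrow> (nat \<Rightarrow> 'a) \<Rightarrow> nat \<Rightarrow> 'a" where
  "splice_rows b f g l = (if l < b then f l else g l)"

text \<open>\<open>G\<close> is multilinear and alternating in the first \<open>b\<close> rows, so
  it is determined by its values on strictly increasing tuples of unit vectors, one for each
  \<open>b\<close>-element subset of \<open>{..<r}\<close>.\<close>

lemma alternating_sum_eq_0:
  fixes c :: "'i \<Rightarrow> 'a::comm_ring_1" and v :: "'i \<Rightarrow> nat \<Rightarrow> nat \<Rightarrow> 'a" and b r :: nat and I :: "'i set"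
  defines "G \<equiv> \<lambda>f. \<Sum>j\<in>I. c j * det (mat r r (\<lambda>(l,k). splice_rows b f (v j) l k))"
  assumes "b \<le> r"
    and subsets: "\<And>S. S \<subseteq> {..<r} \<Longrightarrow> card S = b \<Longrightarrow>
      G (\<lambda>l k. of_bool (k = sorted_list_of_set S ! l)) = 0"
  shows "G f = 0"
proof -
  have units: "G (\<lambda>l k. of_bool (k = \<kappa> l)) = 0" if \<kappa>: "\<And>l. l < b \<Longrightarrow> \<kappa> l < r" for \<kappa> :: "nat \<Rightarrow> nat"
  proof (cases "inj_on \<kappa> {..<b}")
    case False
    then obtain x y where xy: "x < b" "y < b" "x \<noteq> y" "\<kappa> x = \<kappa> y"
      by (auto simp: inj_on_def)
    have "det (mat r r (\<lambda>(l,k). splice_rows b (\<lambda>l k. of_bool (k = \<kappa> l)) (v j) l k)) = 0" for j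
      by (rule det_identical_rows[of _ r, OF _ xy(3)])
        (use xy \<open>b \<le> r\<close> in \<open>auto simp: splice_rows_def intro!: eq_vecI\<close>)
    then show ?thesis by (simp add: G_def)
  next
    case True
    define S where "S = \<kappa> ` {..<b}"
    let ?ys = "sorted_list_of_set S"
    have S: "S \<subseteq> {..<r}" "card S = b" "finite S"
      using \<kappa> True by (auto simp: S_def card_image)
    \<comment> \<open>Sorting the injective index tuple gives a permutation \<open>p\<close> that
      fixes all rows from \<open>b\<close> on. Its sign does not depend on \<open>j\<close>, so it
      factors out of \<open>G\<close>.\<close>
    have "mset (map \<kappa> [0..<b]) = mset_set S"
      using image_mset_mset_set[OF True] by (simp add: S_def atLeast0LessThan)
    also have "\<dots> = mset ?ys"
      using mset_sorted_list_of_multiset[of "mset_set S"] by simp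
    finally obtain p where p: "p permutes {..<length ?ys}" "permute_list p ?ys = map \<kappa> [0..<b]"
      by (rule mset_eq_permutation)
    have len: "length ?ys = b" using S by simp
    have pl: "\<kappa> l = ?ys ! p l" if "l < b" for l
      using arg_cong[OF p(2), of "\<lambda>xs. xs ! l"] permute_list_nth[OF p(1), of l] that len by simp
    have pr: "p permutes {0..<r}"
      by (rule permutes_subset[OF p(1)]) (use len \<open>b \<le> r\<close> in auto)
    have pb: "p l < b \<longleftrightarrow> l < b" for l
      using permutes_in_image[OF p(1), of l] len by simp
    have pid: "p l = l" if "\<not> l < b" for l
      using permutes_not_in[OF p(1), of l] len that by simp
    have pr': "p l < r" if "l < r" for l
      using permutes_in_image[OF pr, of l] that by simp
    have "det (mat r r (\<lambda>(l,k). splice_rows b (\<lambda>l k. of_bool (k = \<kappa> l)) (v j) l k)) =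
        signof p * det (mat r r (\<lambda>(l,k). splice_rows b (\<lambda>l k. of_bool (k = ?ys ! l)) (v j) l k))"
      (is "det ?A = signof p * det ?B") for j
    proof -
      have "?A = mat r r (\<lambda>(l,k). ?B $$ (p l, k))"
        by (intro eq_matI) (auto simp: splice_rows_def pl pb pid pr')
      then show ?thesis using det_permute_rows[OF _ pr, of ?B] by simp
    qed
    then have "G (\<lambda>l k. of_bool (k = \<kappa> l)) = signof p * G (\<lambda>l k. of_bool (k = ?ys ! l))"
      by (simp add: G_def sum_distrib_left mult.left_commute)
    then show ?thesis using subsets[OF S(1,2)] by simp
  qed
  \<comment> \<open>Induction on \<open>d\<close>, the number of leading rows that may still be
    arbitrary; rows \<open>d\<close> to \<open>b - 1\<close> are already unit rows indexed by
    \<open>\<kappa>\<close>. The induction step expands the last arbitrary row.\<close>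
  have "G f = 0" if "d \<le> b" "\<And>l. d \<le> l \<Longrightarrow> l < b \<Longrightarrow> \<kappa> l < r \<and> f l = (\<lambda>k. of_bool (k = \<kappa> l))"
    for d f and \<kappa> :: "nat \<Rightarrow> nat"
    using that
  proof (induction d arbitrary: f \<kappa>)
    case 0
    have "G f = G (\<lambda>l k. of_bool (k = \<kappa> l))"
      unfolding G_def by (intro sum.cong arg_cong2[of _ _ _ _ "(*)"] arg_cong[of _ _ det] eq_matI)
        (use 0 in \<open>auto simp: splice_rows_def\<close>)
    then show ?case using units 0 by auto
  next
    case (Suc d)
    let ?f = "\<lambda>q. f(d := \<lambda>k. of_bool (k = q))"
    have "G f = (\<Sum>j\<in>I. c j * (\<Sum>q<r. f d q *
        det (mat r r (\<lambda>(l,k). splice_rows b (?f q) (v j) l k))))"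
      unfolding G_def
    proof (intro sum.cong refl arg_cong2[of _ _ _ _ "(*)"])
      fix j
      have eq: "(splice_rows b f (v j))(d := \<lambda>k. of_bool (k = q)) = splice_rows b (?f q) (v j)" for q
        using Suc.prems by (auto simp: splice_rows_def fun_eq_iff)
      have "splice_rows b f (v j) d = f d" using Suc.prems by (simp add: splice_rows_def)
      then show "det (mat r r (\<lambda>(l,k). splice_rows b f (v j) l k)) = (\<Sum>q<r. f d q *
        det (mat r r (\<lambda>(l,k). splice_rows b (?f q) (v j) l k)))"
        using det_row_expand_unit[of d r "splice_rows b f (v j)"] Suc.prems(1) \<open>b \<le> r\<close>
        unfolding eq by simp
    qed
    also have "\<dots> = (\<Sum>q<r. f d q * G (?f q))"
      unfolding G_def sum_distrib_left by (subst sum.swap) (simp add: mult.left_commute)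
    also have "\<dots> = 0"
    proof (intro sum.neutral ballI)
      fix q assume "q \<in> {..<r}"
      then have "G (?f q) = 0"
        using Suc.prems by (intro Suc.IH[where \<kappa> = "\<kappa>(d := q)"]) auto
      then show "f d q * G (?f q) = 0" by simp
    qed
    finally show ?case .
  qed
  \<comment> \<open>For \<open>d = b\<close> the condition on unit rows is vacuous, so every
    \<open>f\<close> is covered.\<close>
  from this[of b _ f] show ?thesis by simp
qed

text \<open>With the rows of \<open>u j\<close> from \<open>b\<close> on held fixed, the determinant
  is an alternating form in \<open>b\<close> rows, determined by \<open>r choose b\<close> values.
  More forms than that satisfy a nontrivial linear relation, which the triangular vanishing pattern
  excludes.\<close>

lemma skew_bollobas_det:
  fixes u :: "'i::linorder \<Rightarrow> nat \<Rightarrow> nat \<Rightarrow> 'a::idom"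
  assumes "finite I" "b \<le> r"
    and nz: "\<And>i. i \<in> I \<Longrightarrow> det (mat r r (\<lambda>(l,k). u i l k)) \<noteq> 0"
    and z: "\<And>i j. i \<in> I \<Longrightarrow> j \<in> I \<Longrightarrow> i < j \<Longrightarrow>
      det (mat r r (\<lambda>(l,k). splice_rows b (u i) (u j) l k)) = 0"
  shows "card I \<le> r choose b"
proof (rule ccontr)
  assume "\<not> ?thesis"
  moreover define T where "T = {S. S \<subseteq> {..<r} \<and> card S = b}"
  moreover have "card T = r choose b" using n_subsets[of "{..<r}" b] by (simp add: T_def)
  moreover have "finite T" by (simp add: T_def)
  ultimately have "finite T" "card T < card I" by simp_all
  then obtain c where c: "\<exists>i\<in>I. c i \<noteq> 0" and
    ker: "\<And>S. S \<in> T \<Longrightarrow> (\<Sum>i\<in>I. det (mat r r (\<lambda>(l,k).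
      splice_rows b (\<lambda>l k. of_bool (k = sorted_list_of_set S ! l)) (u i) l k)) * c i) = 0"
    by (rule nontrivial_kernel[OF \<open>finite I\<close>, where A = "\<lambda>S i. det (mat r r (\<lambda>(l,k).
      splice_rows b (\<lambda>l k. of_bool (k = sorted_list_of_set S ! l)) (u i) l k))"]) blast
  \<comment> \<open>With \<open>i\<close> least in the support of \<open>c\<close>, evaluation at
    \<open>u i\<close> isolates one term: \<open>c j = 0\<close> for \<open>j < i\<close>, and the
    determinant vanishes by \<open>z\<close> for \<open>j > i\<close>.\<close>
  define i where "i = Min {i \<in> I. c i \<noteq> 0}"
  have "i \<in> {i \<in> I. c i \<noteq> 0}"
    unfolding i_def by (rule Min_in) (use c \<open>finite I\<close> in auto)
  then have i: "i \<in> I" "c i \<noteq> 0" by auto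
  have le: "i \<le> j" if "j \<in> I" "c j \<noteq> 0" for j
    unfolding i_def using that \<open>finite I\<close> by (intro Min_le) auto
  have "0 = (\<Sum>j\<in>I. c j * det (mat r r (\<lambda>(l,k). splice_rows b (u i) (u j) l k)))"
    by (rule alternating_sum_eq_0[symmetric, OF \<open>b \<le> r\<close>])
      (use ker in \<open>simp add: T_def mult.commute\<close>)
  also have "\<dots> = (\<Sum>j\<in>I. if j = i then c i * det (mat r r (\<lambda>(l,k). u i l k)) else 0)"
  proof (intro sum.cong refl)
    fix j assume "j \<in> I"
    have "splice_rows b (u i) (u i) = u i" by (auto simp: splice_rows_def)
    then show "c j * det (mat r r (\<lambda>(l,k). splice_rows b (u i) (u j) l k)) =
      (if j = i then c i * det (mat r r (\<lambda>(l,k). u i l k)) else 0)"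
      using le[OF \<open>j \<in> I\<close>] z[OF i(1) \<open>j \<in> I\<close>] by (cases "c j = 0") (use i in \<open>force+\<close>)
  qed
  also have "\<dots> \<noteq> 0" using i nz[OF i(1)] \<open>finite I\<close> by simp
  finally show False by simp
qed

section \<open>Singular members of matrix pencils and simultaneous nonsingularity\<close>

lemma det_pencil_poly:
  fixes A B :: "nat \<Rightarrow> nat \<Rightarrow> 'a::comm_ring_1"
  shows "poly (det (mat r r (\<lambda>(l,k). [:A l k, B l k:]))) x = det (mat r r (\<lambda>(l,k). A l k + x * B l k))"
proof -
  have "map_mat (\<lambda>p. poly p x) (mat r r (\<lambda>(l,k). [:A l k, B l k:])) = mat r r (\<lambda>(l,k). A l k + x * B l k)"
    by (intro eq_matI) auto
  then show ?thesis
    using comm_ring_hom.hom_det[OF poly_hom.comm_ring_hom_axioms[of x],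
      where A = "mat r r (\<lambda>(l,k). [:A l k, B l k:])"] by simp
qed

lemma finite_singular_pencil_right:
  fixes A B :: "nat \<Rightarrow> nat \<Rightarrow> 'a::idom"
  assumes "det (mat r r (\<lambda>(l,k). A l k)) \<noteq> 0"
  shows "finite {x. det (mat r r (\<lambda>(l,k). A l k + x * B l k)) = 0}"
proof -
  \<comment> \<open>At 0 the pencil polynomial takes the value \<open>det A\<close>, so it is
    nonzero and has finitely many roots.\<close>
  have "poly (det (mat r r (\<lambda>(l,k). [:A l k, B l k:]))) 0 \<noteq> 0"
    using assms by (simp add: det_pencil_poly)
  then have "det (mat r r (\<lambda>(l,k). [:A l k, B l k:])) \<noteq> 0" by auto
  from poly_roots_finite[OF this] show ?thesis by (simp add: det_pencil_poly)
qed

text \<open>Multiplying by the adjugate of \<open>B\<close> turns the pencil into a characteristic matrix.\<close>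

lemma finite_singular_pencil_left:
  fixes A B :: "nat \<Rightarrow> nat \<Rightarrow> 'a::idom"
  assumes "det (mat r r (\<lambda>(l,k). B l k)) \<noteq> 0"
  shows "finite {x. det (mat r r (\<lambda>(l,k). A l k + x * B l k)) = 0}"
proof -
  define MA MB where "MA = mat r r (\<lambda>(l,k). A l k)" and "MB = mat r r (\<lambda>(l,k). B l k)"
  define C where "C = MA * adj_mat MB"
  have car: "MA \<in> carrier_mat r r" "MB \<in> carrier_mat r r" by (simp_all add: MA_def MB_def)
  note adj = adj_mat[OF car(2)]
  have C: "C \<in> carrier_mat r r" using car adj(1) by (simp add: C_def)
  let ?p = "char_poly (- C)"
  have p: "?p \<noteq> 0" using degree_monic_char_poly[of "-C" r] C by force
  \<comment> \<open>The product of the pencil with \<open>adj_mat MB\<close> is \<open>C\<close>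
    plus \<open>x * det MB\<close> times the identity, whose determinant is \<open>?p\<close> at
    \<open>x * det MB\<close>. Multiplication by the nonzero \<open>det MB\<close> is injective, so
    finiteness later pulls back to \<open>x\<close>.\<close>
  have "poly ?p (x * det MB) = 0" if "det (mat r r (\<lambda>(l,k). A l k + x * B l k)) = 0" for x
  proof -
    let ?M = "mat r r (\<lambda>(l,k). A l k + x * B l k)"
    have M: "?M = MA + x \<cdot>\<^sub>m MB" by (intro eq_matI) (auto simp: MA_def MB_def)
    have "?M * adj_mat MB = C + x \<cdot>\<^sub>m (MB * adj_mat MB)"
      unfolding M C_def using car adj(1) by (simp add: add_mult_distrib_mat mult_smult_assoc_mat)
    then have eq: "?M * adj_mat MB = C + (x * det MB) \<cdot>\<^sub>m 1\<^sub>m r"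
      unfolding adj(2) by (auto intro!: eq_matI)
    have "map_mat (\<lambda>p. poly p (x * det MB)) (char_poly_matrix (- C)) = C + (x * det MB) \<cdot>\<^sub>m 1\<^sub>m r"
      using C by (intro eq_matI) (auto simp: char_poly_matrix_def)
    then have "poly ?p (x * det MB) = det (?M * adj_mat MB)"
      unfolding eq char_poly_def
      using comm_ring_hom.hom_det[OF poly_hom.comm_ring_hom_axioms[of "x * det MB"],
        where A = "char_poly_matrix (- C)"] by simp
    also have "\<dots> = det ?M * det (adj_mat MB)" using adj(1) by (intro det_mult) auto
    finally show ?thesis using that by simp
  qed
  then have "(\<lambda>x. x * det MB) ` {x. det (mat r r (\<lambda>(l,k). A l k + x * B l k)) = 0} \<subseteq> {y. poly ?p y = 0}"
    by auto
  then have "finite ((\<lambda>x. x * det MB) ` {x. det (mat r r (\<lambda>(l,k). A l k + x * B l k)) = 0})"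
    using poly_roots_finite[OF p] finite_subset by blast
  then show ?thesis
    by (rule finite_imageD) (use assms in \<open>auto simp: inj_on_def MB_def\<close>)
qed

text \<open>The coefficients are chosen one index at a time. When \<open>q\<close> is added, each
  old \<open>i\<close> excludes finitely many values, because the value 0 keeps its matrix
  nonsingular; \<open>q\<close> itself excludes finitely many, because \<open>A q q\<close> is
  nonsingular. An infinite domain leaves a value over.\<close>

lemma simultaneous_nonsingular_combination:
  fixes A :: "'i \<Rightarrow> 'i \<Rightarrow> nat \<Rightarrow> nat \<Rightarrow> 'a::idom"
  assumes "finite I" "infinite (UNIV :: 'a set)"
    and "\<And>i. i \<in> I \<Longrightarrow> det (mat r r (\<lambda>(l,k). A i i l k)) \<noteq> 0"
  shows "\<exists>y. \<forall>i\<in>I. det (mat r r (\<lambda>(l,k). \<Sum>j\<in>I. y j * A i j l k)) \<noteq> 0"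
  using assms(1,3)
proof (induction I)
  case (insert q I)
  then obtain y where y: "\<And>i. i \<in> I \<Longrightarrow> det (mat r r (\<lambda>(l,k). \<Sum>j\<in>I. y j * A i j l k)) \<noteq> 0"
    by auto
  let ?bad = "\<lambda>i. {x. det (mat r r (\<lambda>(l,k). (\<Sum>j\<in>I. y j * A i j l k) + x * A i q l k)) = 0}"
  have "finite (\<Union>i\<in>insert q I. ?bad i)"
  proof (intro finite_UN_I)
    fix i assume i: "i \<in> insert q I"
    show "finite (?bad i)"
    proof (cases "i = q")
      case True
      then show ?thesis using insert.prems[of q] by (simp add: finite_singular_pencil_left)
    next
      case False
      then show ?thesis using y[of i] i
        by (intro finite_singular_pencil_right[of r "\<lambda>l k. \<Sum>j\<in>I. y j * A i j l k"]) auto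
    qed
  qed (use insert in simp)
  then obtain x where x: "x \<notin> (\<Union>i\<in>insert q I. ?bad i)"
    using ex_new_if_finite[OF assms(2)] by blast
  have "(\<Sum>j\<in>insert q I. (y(q := x)) j * A i j l k) = (\<Sum>j\<in>I. y j * A i j l k) + x * A i q l k" for i l k
  proof -
    have "(\<Sum>j\<in>I. (y(q := x)) j * A i j l k) = (\<Sum>j\<in>I. y j * A i j l k)"
      using insert by (intro sum.cong) auto
    then show ?thesis using insert by (simp add: add.commute)
  qed
  then show ?case using x by (intro exI[of _ "y(q := x)"]) (simp del: fun_upd_apply)
qed simp

lemma infinite_UNIV_poly: "infinite (UNIV :: 'a::idom poly set)"
proof
  assume "finite (UNIV :: 'a poly set)"
  then have "finite (range (\<lambda>n. monom (1::'a) n))" by (rule finite_subset[rotated]) simp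
  then show False
    by (rule range_inj_infinite[THEN notE, rotated]) (metis (no_types, lifting) injI degree_monom_eq one_neq_zero)
qed

lemma det_eq_0_if_rows_dependent:
  fixes M :: "nat \<Rightarrow> nat \<Rightarrow> 'a::idom"
  assumes "l0 < r" "z l0 \<noteq> 0" and z: "\<And>k. k < r \<Longrightarrow> (\<Sum>l<r. z l * M l k) = 0"
  shows "det (mat r r (\<lambda>(l,k). M l k)) = 0"
proof -
  let ?A = "mat r r (\<lambda>(k,l). M l k)"
  have "?A *\<^sub>v vec r z = 0\<^sub>v r"
    using z by (intro eq_vecI) (auto simp: scalar_prod_def mult.commute atLeast0LessThan)
  moreover have "vec r z \<noteq> 0\<^sub>v r" using assms(1,2) by (metis index_vec index_zero_vec(1))
  ultimately have "det ?A = 0"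
    by (subst det_0_iff_vec_prod_zero[of _ r]) (auto intro!: exI[of _ "vec r z"])
  moreover have "transpose_mat (mat r r (\<lambda>(l,k). M l k)) = ?A" by (intro eq_matI) auto
  ultimately show ?thesis using det_transpose[of "mat r r (\<lambda>(l,k). M l k)" r] by simp
qed

section \<open>Coordinate functionals and annihilators of subspaces\<close>

context finite_dimensional_vector_space
begin

text \<open>The functionals are coordinates in a basis adapted to both subspaces, and the
  \<open>w k\<close> are the corresponding basis vectors. Coordinates at vectors outside the basis
  of \<open>U\<close> kill \<open>U\<close>; those at vectors in it but outside the basis of
  \<open>U \<inter> V\<close> kill \<open>V\<close>.\<close>

lemma dual_system_of_subspace_pair:
  assumes U: "subspace U" and V: "subspace V" and "dim (U \<inter> V) + r \<le> dimension"
  obtains b and e :: "nat \<Rightarrow> 'b \<Rightarrow> 'a" and w where "b \<le> r"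
    and "\<And>l. Vector_Spaces.linear scale (*) (e l)"
    and "\<And>l x. l < b \<Longrightarrow> x \<in> U \<Longrightarrow> e l x = 0"
    and "\<And>l x. b \<le> l \<Longrightarrow> l < r \<Longrightarrow> x \<in> V \<Longrightarrow> e l x = 0"
    and "\<And>l k. l < r \<Longrightarrow> k < r \<Longrightarrow> e l (w k) = of_bool (l = k)"
proof -
  \<comment> \<open>Nested bases: \<open>C\<close> of \<open>U \<inter> V\<close>, \<open>A\<close>
    of \<open>U\<close>, \<open>B\<close> of \<open>U + V\<close>, \<open>D\<close> of the whole
    space.\<close>
  obtain C where C: "C \<subseteq> U \<inter> V" "independent C" "U \<inter> V \<subseteq> span C" "card C = dim (U \<inter> V)"
    by (rule basis_exists)
  obtain A where A: "C \<subseteq> A" "A \<subseteq> U" "independent A" "U \<subseteq> span A"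
    by (rule maximal_independent_subset_extend[of C U]) (use C in auto)
  obtain B where B: "A \<subseteq> B" "B \<subseteq> A \<union> V" "independent B" "A \<union> V \<subseteq> span B"
    by (rule maximal_independent_subset_extend[of A "A \<union> V"]) (use A in auto)
  obtain D where D: "B \<subseteq> D" "independent D" "UNIV \<subseteq> span D"
    by (rule maximal_independent_subset_extend[of B UNIV]) (use B in auto)
  have spanD: "x \<in> span D" for x using D(3) by blast
  have "finite D" using D(2) by (rule finiteI_independent)
  have CD: "C \<subseteq> D" using A B D by blast
  have "card D = dim (UNIV :: 'b set)" using D by (intro basis_card_eq_dim) auto
  then have "r \<le> card (D - C)"
    using assms(3) C(4) CD \<open>finite D\<close> by (simp add: card_Diff_subset finite_subset dimension_def)
  then obtain R where R: "R \<subseteq> D - C" "card R = r" "finite R"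
    by (rule obtain_subset_with_card_n)
  \<comment> \<open>Listing the vectors outside \<open>A\<close> first puts the functionals that
    kill \<open>U\<close> below position \<open>b = length xs\<close>.\<close>
  obtain xs where xs: "set xs = R - A" "distinct xs"
    using finite_distinct_list[of "R - A"] \<open>finite R\<close> by auto
  obtain ys where ys: "set ys = R \<inter> A" "distinct ys"
    using finite_distinct_list[of "R \<inter> A"] \<open>finite R\<close> by auto
  have dist: "distinct (xs @ ys)" and set: "set (xs @ ys) = R" using xs ys by auto
  have len: "length (xs @ ys) = r" using distinct_card[OF dist] R(2) unfolding set by simp
  let ?w = "\<lambda>k. (xs @ ys) ! k"
  have repU: "representation D x d = 0" if "x \<in> U" "d \<notin> A" for x d
  proof -
    have "x \<in> span A" using that A by blast
    then have "representation D x = representation A x"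
      using D A B by (intro representation_extend) auto
    then show ?thesis using that(2) representation_ne_zero[of A x d] by auto
  qed
  \<comment> \<open>Split \<open>x = p + q\<close> along \<open>A\<close> and \<open>B - A\<close>.
    Since \<open>B - A\<close> lies in \<open>V\<close>, so does \<open>p\<close>; hence
    \<open>p\<close> lies in \<open>U \<inter> V\<close>, and neither part has a coordinate at a
    vector of \<open>A - C\<close>.\<close>
  have repV: "representation D x d = 0" if "x \<in> V" "d \<in> A" "d \<notin> C" for x d
  proof -
    have "x \<in> span (A \<union> (B - A))" using that(1) B by (auto simp: Un_absorb1)
    then obtain p q where pq: "x = p + q" "p \<in> span A" "q \<in> span (B - A)"
      unfolding span_Un by auto
    have "q \<in> V" using pq(3) B(2) span_minimal[OF _ V, of "B - A"] by blast
    then have "p \<in> V" using pq(1) that(1) subspace_diff[OF V, of x q] by simp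
    moreover have "p \<in> U" using pq(2) A(2) span_minimal[OF _ U, of A] by blast
    ultimately have "p \<in> span C" using C by blast
    have "representation D p = representation C p"
      using D CD \<open>p \<in> span C\<close> by (intro representation_extend) auto
    moreover have "representation D q = representation (B - A) q"
      using D pq by (intro representation_extend) auto
    moreover have "representation C p d = 0" "representation (B - A) q d = 0"
      using that representation_ne_zero[of C p d] representation_ne_zero[of "B - A" q d] by auto
    ultimately show ?thesis
      using representation_add[OF D(2) spanD spanD, of p q] pq(1) by simp
  qed
  show thesis
  proof (rule that[of "length xs" "\<lambda>l x. representation D x (?w l)" ?w])
    show "length xs \<le> r" using len by simp
    show "Vector_Spaces.linear scale (*) (\<lambda>x. representation D x (?w l))" for l
      using D by (intro linear_representation) auto
    show "representation D x (?w l) = 0" if "l < length xs" "x \<in> U" for l x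
      using that xs(1) nth_mem[of l xs] by (intro repU) (auto simp: nth_append)
    show "representation D x (?w l) = 0" if "length xs \<le> l" "l < r" "x \<in> V" for l x
    proof -
      have "?w l \<in> set ys" using that len by (simp add: nth_append)
      then show ?thesis using that(3) ys(1) R(1) by (intro repV) auto
    qed
    show "representation D (?w k) (?w l) = of_bool (l = k)" if "l < r" "k < r" for l k
    proof -
      have "?w k \<in> R" using set nth_mem[of k "xs @ ys"] that(2) len by simp
      then have "?w k \<in> D" using R(1) by blast
      then show ?thesis
        using nth_eq_iff_index_eq[OF dist, of l k] that len representation_basis[OF D(2)] by simp
    qed
  qed
qed

text \<open>Such functionals are determined by their values on the vectors that extend a maximal
  independent subset of \<open>K\<close> to a basis. These are fewer than \<open>r\<close>, so a
  linear relation among \<open>r\<close> functionals is an underdetermined system.\<close>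

lemma functionals_vanishing_dependent:
  fixes e :: "nat \<Rightarrow> 'b \<Rightarrow> 'a"
  assumes lin: "\<And>l. l < r \<Longrightarrow> Vector_Spaces.linear scale (*) (e l)"
    and van: "\<And>l x. l < r \<Longrightarrow> x \<in> K \<Longrightarrow> e l x = 0"
    and "dimension < dim K + r"
  shows "\<exists>z. (\<exists>l<r. z l \<noteq> 0) \<and> (\<forall>x. (\<Sum>l<r. z l * e l x) = 0)"
proof -
  obtain C where C: "C \<subseteq> K" "independent C" "K \<subseteq> span C" "card C = dim K"
    by (rule basis_exists)
  obtain D where D: "C \<subseteq> D" "independent D" "UNIV \<subseteq> span D"
    by (rule maximal_independent_subset_extend[of C UNIV]) (use C in auto)
  have "finite D" using D(2) by (rule finiteI_independent)
  have "card D = dim (UNIV :: 'b set)" using D by (intro basis_card_eq_dim) auto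
  then have "card (D - C) < card {..<r}"
    using assms(3) C(4) D(1) \<open>finite D\<close> card_mono[OF \<open>finite D\<close> D(1)]
    by (simp add: card_Diff_subset finite_subset dimension_def)
  then obtain z where z: "\<exists>l\<in>{..<r}. z l \<noteq> 0" "\<And>s. s \<in> D - C \<Longrightarrow> (\<Sum>l<r. e l s * z l) = 0"
    using nontrivial_kernel[of "{..<r}" "D - C" "\<lambda>s l. e l s"] \<open>finite D\<close> by auto
  interpret vector_space_pair scale "(*) :: 'a \<Rightarrow> 'a \<Rightarrow> 'a"
    by unfold_locales (simp_all add: algebra_simps)
  have "Vector_Spaces.linear scale (*) (\<lambda>x. \<Sum>l<r. z l * e l x)"
    using lin by (intro linear_compose_sum ballI linear_compose_scale_right) auto
  moreover have "(\<Sum>l<r. z l * e l x) = 0" if "x \<in> D" for x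
    using z(2)[of x] van[of _ x] that C(1) by (cases "x \<in> C") (auto simp: mult.commute)
  ultimately have "(\<Sum>l<r. z l * e l x) = 0" for x
    using linear_eq_0_on_span[of "\<lambda>x. \<Sum>l<r. z l * e l x" D x] D(3) by blast
  then show ?thesis using z(1) by blast
qed

end

section \<open>Dual systems for all pairs, generic evaluation, and the count over classes\<close>

theorem theorem6:
  fixes scale :: "'a::field \<Rightarrow> 'b::ab_group_add \<Rightarrow> 'b"
    and Basis :: "'b set"
    and U V :: "nat \<Rightarrow> 'b set"
    and n t m :: nat
  assumes "finite_dimensional_vector_space scale Basis"
    and "vector_space.dim scale (UNIV :: 'b set) = n"
    and "t \<le> n"
    and "\<And>i. i \<in> {1..m} \<Longrightarrow> module.subspace scale (U i)"
    and "\<And>i. i \<in> {1..m} \<Longrightarrow> module.subspace scale (V i)"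
    and "\<And>i. i \<in> {1..m} \<Longrightarrow> vector_space.dim scale (U i \<inter> V i) \<le> t"
    and "\<And>i j. 1 \<le> i \<Longrightarrow> i < j \<Longrightarrow> j \<le> m \<Longrightarrow> vector_space.dim scale (U i \<inter> V j) > t"
  shows "m \<le> 2 ^ (n - t)"
proof -
  interpret finite_dimensional_vector_space scale Basis by (rule assms(1))
  \<comment> \<open>Because \<open>t \<le> n\<close>, the truncated difference satisfies
    \<open>r + t = n\<close>.\<close>
  define r where "r = n - t"
  have n: "dimension = n" using assms(2) dimension_def by simp
  let ?I = "{1..m}"
  have "\<forall>i\<in>?I. \<exists>b (e :: nat \<Rightarrow> 'b \<Rightarrow> 'a) w. b \<le> r
      \<and> (\<forall>l. Vector_Spaces.linear scale (*) (e l))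
      \<and> (\<forall>l x. l < b \<longrightarrow> x \<in> U i \<longrightarrow> e l x = 0)
      \<and> (\<forall>l x. b \<le> l \<longrightarrow> l < r \<longrightarrow> x \<in> V i \<longrightarrow> e l x = 0)
      \<and> (\<forall>l k. l < r \<longrightarrow> k < r \<longrightarrow> e l (w k) = of_bool (l = k))"
    (is "\<forall>i\<in>?I. \<exists>b e w. ?P i b e w")
  proof
    fix i assume i: "i \<in> ?I"
    have le: "dim (U i \<inter> V i) + r \<le> dimension"
      using assms(3) assms(6)[OF i] by (simp add: n r_def)
    show "\<exists>b e w. ?P i b e w"
      by (rule dual_system_of_subspace_pair[OF assms(4,5)[OF i] le], intro exI conjI allI impI)
  qed
  then have "\<exists>b e w. \<forall>i\<in>?I. ?P i (b i) (e i) (w i)" by (simp only: bchoice_iff)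
  then obtain b e w where P: "\<forall>i\<in>?I. ?P i (b i) (e i) (w i)" by (elim exE)
  have b: "b i \<le> r" and lin: "Vector_Spaces.linear scale (*) (e i l)"
    and eU: "l < b i \<Longrightarrow> x \<in> U i \<Longrightarrow> e i l x = 0"
    and eV: "b i \<le> l \<Longrightarrow> l < r \<Longrightarrow> x \<in> V i \<Longrightarrow> e i l x = 0"
    and dual: "l < r \<Longrightarrow> k < r \<Longrightarrow> e i l (w i k) = of_bool (l = k)"
    if "i \<in> ?I" for i l k x
    using bspec[OF P that] by simp_all
  \<comment> \<open>Embedding the values as constant polynomials supplies an infinite coefficient
    domain. For \<open>j = i\<close> the matrix of values is the identity by duality, as the
    combination lemma requires.\<close>
  have "\<exists>y. \<forall>i\<in>?I. det (mat r r (\<lambda>(l,k). \<Sum>j\<in>?I. y j * [:e i l (w j k):])) \<noteq> 0"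
  proof (rule simultaneous_nonsingular_combination)
    fix i assume "i \<in> ?I"
    then have "mat r r (\<lambda>(l,k). [:e i l (w i k):]) = 1\<^sub>m r"
      by (intro eq_matI) (auto simp: dual)
    then show "det (mat r r (\<lambda>(l,k). [:e i l (w i k):])) \<noteq> 0" by simp
  qed (simp_all add: infinite_UNIV_poly)
  then obtain y where
    y: "\<And>i. i \<in> ?I \<Longrightarrow> det (mat r r (\<lambda>(l,k). \<Sum>j\<in>?I. y j * [:e i l (w j k):])) \<noteq> 0"
    by blast
  \<comment> \<open>\<open>\<rho> i l k\<close> is the functional \<open>e i l\<close>, extended to
    polynomial coefficients, at the \<open>k\<close>-th generic vector: the combination of the
    \<open>w j k\<close> with coefficients \<open>y j\<close>.\<close>
  define \<rho> where "\<rho> = (\<lambda>i l k. \<Sum>j\<in>?I. y j * [:e i l (w j k):])"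
  have card_class: "card {i \<in> ?I. b i = d} \<le> r choose d" if "d \<le> r" for d
  proof (rule skew_bollobas_det[where u = \<rho>])
    show "det (mat r r (\<lambda>(l,k). \<rho> i l k)) \<noteq> 0" if "i \<in> {i \<in> ?I. b i = d}" for i
      using y that by (simp add: \<rho>_def)
    fix i j assume ij: "i \<in> {i \<in> ?I. b i = d}" "j \<in> {i \<in> ?I. b i = d}" "i < j"
    \<comment> \<open>As \<open>b i = b j = d\<close>, the first \<open>d\<close> functionals kill
      \<open>U i\<close> and the others up to \<open>r\<close> kill \<open>V j\<close>. All of them
      vanish on \<open>U i \<inter> V j\<close>, whose codimension is below
      \<open>r\<close>.\<close>
    let ?f = "splice_rows d (e i) (e j)"
    have dim_gt: "dimension < dim (U i \<inter> V j) + r"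
      using assms(7)[of i j] ij assms(3) by (simp add: n r_def)
    have lin_f: "Vector_Spaces.linear scale (*) (?f l)" for l
      using ij lin by (simp add: splice_rows_def)
    have vanish: "?f l x = 0" if "l < r" "x \<in> U i \<inter> V j" for l x
      using that ij eU[of i l x] eV[of j l x] by (auto simp: splice_rows_def)
    obtain z l0 where z: "l0 < r" "z l0 \<noteq> 0" "\<And>x. (\<Sum>l<r. z l * ?f l x) = 0"
      using functionals_vanishing_dependent[where e = ?f, OF lin_f vanish dim_gt] by blast
    show "det (mat r r (\<lambda>(l,k). splice_rows d (\<rho> i) (\<rho> j) l k)) = 0"
    \<comment> \<open>The relation \<open>z\<close> holds at every vector, hence at each
      \<open>w q k\<close>. Read as constant polynomials, its coefficients give a relation among the
      rows at the generic vectors.\<close>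
    proof (rule det_eq_0_if_rows_dependent[where z = "\<lambda>l. [:z l:]"])
      fix k
      have "(\<Sum>l<r. [:z l:] * splice_rows d (\<rho> i) (\<rho> j) l k)
          = (\<Sum>l<r. \<Sum>q\<in>?I. y q * [:z l * ?f l (w q k):])"
        by (intro sum.cong refl) (simp add: splice_rows_def \<rho>_def smult_sum2)
      also have "\<dots> = (\<Sum>q\<in>?I. y q * (\<Sum>l<r. [:z l * ?f l (w q k):]))"
        by (subst sum.swap) (simp add: sum_distrib_left)
      also have "\<dots> = 0"
      proof (intro sum.neutral ballI)
        fix q
        have "(\<Sum>l<r. [:z l * ?f l (w q k):]) = [:\<Sum>l<r. z l * ?f l (w q k):]"
          by (intro poly_eqI) (simp add: coeff_sum coeff_pCons split: nat.split)
        then show "y q * (\<Sum>l<r. [:z l * ?f l (w q k):]) = 0" by (simp add: z)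
      qed
      finally show "(\<Sum>l<r. [:z l:] * splice_rows d (\<rho> i) (\<rho> j) l k) = 0" .
    qed (use z in simp_all)
  qed (use that in simp_all)
  have "m = card (\<Union>d\<le>r. {i \<in> ?I. b i = d})"
  proof -
    have "(\<Union>d\<le>r. {i \<in> ?I. b i = d}) = ?I" using b by auto
    then show ?thesis by simp
  qed
  also have "\<dots> \<le> (\<Sum>d\<le>r. card {i \<in> ?I. b i = d})" by (rule card_UN_le) simp
  also have "\<dots> \<le> (\<Sum>d\<le>r. r choose d)" using card_class by (intro sum_mono) auto
  also have "\<dots> = 2 ^ (n - t)" by (simp add: choose_row_sum r_def)
  finally show ?thesis .
qed

end
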